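(* Let $X_1,X_2,\ldots$ be i.i.d. real random variables with common distribution function $F(x)=\mathsf P(X_1<x)$, let $H_\tau$ be an extreme value distribution function, and assume $F\in\max\text{-}DA(H_\tau)$. Let $\lambda>0$ and let $N_\lambda$ be a random variable with the Poisson distribution with parameter $\lambda$, independent of the sequence $X_1,X_2,\ldots$. Let the numbers $a\in\mathbb R$, $b>0$, $x\in\mathbb R$, $s\in(0,1)$ satisfy $H_\tau(x)>0$ and $|\rho_\lambda(x)|\le 3s$, where $$\rho_\lambda(x)=\lambda\bigl(1-F(a+bx)\bigr)+\log H_\tau(x).$$ Then $$\Big|\mathsf P\Big(\max_{1\le i\le N_\lambda}X_i<a+bx\Big)-H_\tau(x)\Big|\le H_\tau(x)\Big[|\rho_\lambda(x)|+\frac{(\rho_\lambda(x))^2}{2(1-s)}\Big].$$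
   Context: Distribution functions are left-continuous: $F(x)=\mathsf P(X<x)$. Convention: $\max_{1\le i\le N}X_i=-\infty$ if $N=0$. Extreme value distribution functions: up to location and scale parameters, $H_\tau$ ($\tau\in\mathbb R$) is $\exp\{-(1+\tau x)^{-1/\tau}\}$ where $1+\tau x>0$ (for $\tau=0$: $\exp\{-e^{-x}\}$, $x\in\mathbb R$), extended by $0$ when $\tau>0$ and $1+\tau x\le 0$, and by $1$ when $\tau<0$ and $1+\tau x\le0$. Equivalently, with $\gamma=1/|\tau|$ when $\tau\ne0$, it is up to location and scale one of: $\exp\{-x^{-\gamma}\}$ for $x>0$ and $0$ for $x\le0$ ($\tau>0$); $\exp\{-|x|^\gamma\}$ for $x<0$ and $1$ for $x\ge0$ ($\tau<0$); $\exp\{-e^{-x}\}$ ($\tau=0$). $F\in\max\text{-}DA(H_\tau)$ means that there are sequences of centering constants and positive normalizing constants such that the distribution functions of the linearly normalized maxima $\max_{1\le i\le n}X_i$ converge weakly to $H_\tau$. *)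

theory Defs
  imports "HOL-Probability.Probability"
begin

text \<open>Distribution functions are left-continuous here (strict inequality), unlike the
  library's \<^const>\<open>cdf\<close>.\<close>

definition left_cdf :: "'a measure \<Rightarrow> ('a \<Rightarrow> real) \<Rightarrow> real \<Rightarrow> real" where
  "left_cdf M Y x = measure M {\<omega> \<in> space M. Y \<omega> < x}"

text \<open>Sequences are indexed from 1; the entry at index 0 is never used.\<close>

definition iid_seq :: "'a measure \<Rightarrow> (nat \<Rightarrow> 'a \<Rightarrow> real) \<Rightarrow> (real \<Rightarrow> real) \<Rightarrow> bool" where
  "iid_seq M X F \<longleftrightarrow>
     prob_space.indep_vars M (\<lambda>_. borel) X {1..} \<and> (\<forall>i\<ge>1. left_cdf M (X i) = F)"

text \<open>The library's \<^const>\<open>prob_space.indep_var\<close> requires both variables to have the same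
  type of values; this is the same notion without that restriction.\<close>

definition indep_rv :: "'a measure \<Rightarrow> 'b measure \<Rightarrow> ('a \<Rightarrow> 'b) \<Rightarrow> 'c measure \<Rightarrow> ('a \<Rightarrow> 'c) \<Rightarrow> bool" where
  "indep_rv M S Y T Z \<longleftrightarrow>
     Y \<in> measurable M S \<and> Z \<in> measurable M T \<and>
     prob_space.indep_set M {Y -` A \<inter> space M |A. A \<in> sets S} {Z -` A \<inter> space M |A. A \<in> sets T}"

definition max_upto :: "(nat \<Rightarrow> real) \<Rightarrow> nat \<Rightarrow> ereal" where
  "max_upto y n = (if n = 0 then -\<infinity> else ereal (MAX i\<in>{1..n}. y i))"

definition std_extreme_value :: "real \<Rightarrow> real \<Rightarrow> real" where
  "std_extreme_value \<tau> x =
     (if \<tau> = 0 then exp (- exp (- x))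
      else if 1 + \<tau> * x > 0 then exp (- ((1 + \<tau> * x) powr (- 1 / \<tau>)))
      else if \<tau> > 0 then 0 else 1)"

definition extreme_value :: "real \<Rightarrow> (real \<Rightarrow> real) \<Rightarrow> bool" where
  "extreme_value \<tau> H \<longleftrightarrow>
     (\<exists>\<mu> \<sigma>. \<sigma> > 0 \<and> (\<forall>x. H x = std_extreme_value \<tau> ((x - \<mu>) / \<sigma>)))"

text \<open>Membership depends only on the law of the i.i.d. sequence, so nothing is lost by
  realising the sequence on a probability space over the sequences of reals. The term for
  \<open>n = 0\<close>, which involves the maximum of an empty set, does not affect the limit.\<close>

definition max_DA :: "(real \<Rightarrow> real) \<Rightarrow> (real \<Rightarrow> real) set" where
  "max_DA H = {F. \<exists>(M :: (nat \<Rightarrow> real) measure) X c d.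
     prob_space M \<and> iid_seq M X F \<and> (\<forall>n. d n > 0) \<and>
     weak_conv (\<lambda>n. left_cdf M (\<lambda>\<omega>. ((MAX i\<in>{1..n}. X i \<omega>) - c n) / d n)) H}"

end

theory Submission
  imports Defs
begin

text \<open>Conditioning on the Poisson size gives \<open>P(max < y) = exp (- lam * (1 - F y))\<close> exactly, which at
  \<open>y = a + b * x\<close> is \<open>H x * exp (- \<rho> x)\<close>. It remains to bound \<open>exp z - 1\<close> for \<open>z = - \<rho> x\<close>: since
  \<open>2 * 3^k \<le> (k+2)!\<close>, the exponential series beyond its linear term is dominated by a geometric
  series with ratio \<open>\<bar>z\<bar> / 3 \<le> s\<close>.\<close>

text \<open>Besides 1 and 2, the product \<open>(k + 2)!\<close> has the \<open>k\<close> factors 3,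
  ..., \<open>k + 2\<close>, each at least 3.\<close>

lemma two_mult_three_power_le_fact: "2 * 3 ^ k \<le> (fact (k + 2) :: real)"
proof (induction k)
  case 0
  then show ?case by (simp add: fact_numeral)
next
  case (Suc k)
  have "2 * 3 ^ Suc k = 3 * (2 * 3 ^ k :: real)" by simp
  also have "\<dots> \<le> real (k + 3) * fact (k + 2)"
    using Suc.IH by (intro mult_mono) auto
  also have "\<dots> = fact (Suc k + 2)" by (simp add: algebra_simps)
  finally show ?case .
qed

lemma exp_minus_linear_bound:
  fixes z s :: real
  assumes "\<bar>z\<bar> \<le> 3 * s" "s < 1"
  shows "\<bar>exp z - 1 - z\<bar> \<le> z\<^sup>2 / (2 * (1 - s))"
proof -
  let ?f = "\<lambda>k. z ^ (k + 2) /\<^sub>R fact (k + 2)"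
  let ?g = "\<lambda>k. z\<^sup>2 / 2 * s ^ k"
  \<comment> \<open>Nonnegativity of \<open>s\<close> is implicit in the bound on the absolute value
    of \<open>z\<close>.\<close>
  have s0: "0 \<le> s" using assms(1) by linarith
  have f: "?f sums (exp z - 1 - z)"
    using sums_split_initial_segment[OF exp_converges[of z], of 2]
    by (simp add: numeral_2_eq_2 algebra_simps)
  have g: "?g sums (z\<^sup>2 / 2 * (1 / (1 - s)))"
    by (intro sums_mult geometric_sums) (use s0 assms(2) in simp)
  have fg: "norm (?f k) \<le> ?g k" for k
  proof -
    have "norm (?f k) = z\<^sup>2 * \<bar>z\<bar> ^ k / fact (k + 2)"
      by (simp add: power_add abs_mult power_abs power2_eq_square divide_inverse mult_ac del: fact_Suc)
    \<comment> \<open>The constant 3 in the hypothesis on \<open>z\<close> is chosen for this step: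
      it cancels the \<open>3 ^ k\<close> from the factorial bound and leaves the ratio
      \<open>s\<close>.\<close>
    also have "\<dots> \<le> z\<^sup>2 * (3 * s) ^ k / (2 * 3 ^ k)"
      using assms(1) s0
      by (intro frac_le mult_left_mono power_mono two_mult_three_power_le_fact) auto
    also have "\<dots> = ?g k" by (simp add: power_mult_distrib)
    finally show ?thesis .
  qed
  have "\<bar>suminf ?f\<bar> \<le> suminf ?g"
    using norm_suminf_le[OF fg sums_summable[OF g]] by simp
  then show ?thesis
    using f g by (simp add: sums_unique[symmetric])
qed

text \<open>For \<open>n = 0\<close> both sides are true: the empty maximum is -\<infinity>, and the
  right side is vacuous. Hence the event \<open>N = 0\<close> contributes its full probability
  below.\<close>

lemma max_upto_less_iff: "max_upto y n < ereal t \<longleftrightarrow> (\<forall>i\<in>{1..n}. y i < t)"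
  by (auto simp: max_upto_def)

lemma (in prob_space) iid_seq_prob_all_less:
  assumes "iid_seq M X F"
  shows "prob {\<omega> \<in> space M. \<forall>i\<in>{1..n}. X i \<omega> < t} = F t ^ n"
\<comment> \<open>The product rule for independent variables needs a nonempty index set; moreover,
  the empty intersection would be \<open>UNIV\<close> instead of \<open>space M\<close>.\<close>
proof (cases "n = 0")
  case True
  then show ?thesis by (simp add: prob_space)
next
  case False
  have "indep_vars (\<lambda>_. borel) X {1..}" and F: "\<And>i. i \<ge> 1 \<Longrightarrow> left_cdf M (X i) = F"
    using assms by (auto simp: iid_seq_def)
  then have "prob (\<Inter>i\<in>{1..n}. X i -` {..<t} \<inter> space M) = (\<Prod>i\<in>{1..n}. prob (X i -` {..<t} \<inter> space M))"
    using False by (intro indep_varsD) auto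
  also have "\<dots> = (\<Prod>i\<in>{1..n}. F t)"
  proof (rule prod.cong)
    fix i assume "i \<in> {1..n}"
    then have "F t = left_cdf M (X i) t" using F by simp
    also have "\<dots> = prob (X i -` {..<t} \<inter> space M)"
      unfolding left_cdf_def by (rule arg_cong[where f = prob]) auto
    finally show "prob (X i -` {..<t} \<inter> space M) = F t" ..
  qed simp
  also have "(\<Inter>i\<in>{1..n}. X i -` {..<t} \<inter> space M) = {\<omega> \<in> space M. \<forall>i\<in>{1..n}. X i \<omega> < t}"
    using False by auto
  finally show ?thesis by simp
qed

text \<open>Given \<open>N = n\<close> the probability is \<open>F t ^ n\<close>, so the result is
  the generating function of the Poisson law evaluated at \<open>F t\<close>.\<close>

lemma (in prob_space) prob_max_upto_poisson:
  assumes iid: "iid_seq M X F"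
    and lam: "lam > 0"
    and N: "N \<in> measurable M (count_space UNIV)"
    and law: "distr M (count_space UNIV) N = measure_pmf (poisson_pmf lam)"
    and ind: "indep_rv M (count_space UNIV) N
           (PiM {1..} (\<lambda>_. borel)) (\<lambda>\<omega>. \<lambda>i\<in>{1..}. X i \<omega>)"
  shows "prob {\<omega> \<in> space M. max_upto (\<lambda>i. X i \<omega>) (N \<omega>) < ereal t} = exp (- lam * (1 - F t))"
proof -
  let ?Z = "\<lambda>\<omega>. \<lambda>i\<in>{1..}. X i \<omega>"
  let ?P = "PiM {1..} (\<lambda>_. borel) :: (nat \<Rightarrow> real) measure"
  define A where "A n = N -` {n} \<inter> space M" for n
  define B where "B n = {\<omega> \<in> space M. \<forall>i\<in>{1..n}. X i \<omega> < t}" for n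
  \<comment> \<open>\<open>N\<close> is independent of the sequence as a whole, so
    \<open>B n\<close> has to be the preimage of a measurable set of sequences. \<open>C n\<close>
    is that set; restricting the sequence to indices from 1 on leaves the coordinates in
    \<open>{1..n}\<close> unchanged.\<close>
  define C where "C n = {f \<in> space ?P. \<forall>i\<in>{1..n}. f i < t}" for n
  have Z: "?Z \<in> measurable M ?P"
    and ind': "indep_set {N -` A \<inter> space M |A. A \<in> sets (count_space UNIV)}
                 {?Z -` A \<inter> space M |A. A \<in> sets ?P}"
    using ind by (auto simp: indep_rv_def)
  have C: "C n \<in> sets ?P" for n
    unfolding C_def
    by (intro sets.sets_Collect_finite_All borel_measurable_less measurable_component_singleton
          borel_measurable_const) auto
  have BC: "B n = ?Z -` C n \<inter> space M" for n
    using measurable_space[OF Z] by (auto simp: B_def C_def)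
  have A_sets: "A n \<in> sets M" for n
    unfolding A_def using N by (rule measurable_sets) simp
  have B_sets: "B n \<in> sets M" for n
    unfolding BC using Z C by (rule measurable_sets)
  have pA: "prob (A n) = lam ^ n / fact n * exp (- lam)" for n
  proof -
    have "prob (A n) = measure (distr M (count_space UNIV) N) {n}"
      unfolding A_def using N by (simp add: measure_distr)
    also have "\<dots> = pmf (poisson_pmf lam) n" by (simp add: law measure_pmf_single)
    finally show ?thesis using lam by simp
  qed
  have pAB: "prob (A n \<inter> B n) = prob (A n) * prob (B n)" for n
    by (rule indep_setD[OF ind']) (use C in \<open>auto simp: A_def BC\<close>)
  have pB: "prob (B n) = F t ^ n" for n
    unfolding B_def using iid by (rule iid_seq_prob_all_less)
  \<comment> \<open>Apart from the constant \<open>exp (- lam)\<close>, these are the terms of the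
    exponential series at \<open>lam * F t\<close>.\<close>
  have pAB_eq: "prob (A n \<inter> B n) = exp (- lam) * ((lam * F t) ^ n /\<^sub>R fact n)" for n
    unfolding pAB pA pB
    by (simp add: power_mult_distrib divide_inverse mult_ac)
  \<comment> \<open>Countable additivity applies because the events \<open>A n\<close> fix different
    values of \<open>N\<close> and are thus disjoint.\<close>
  have "(\<lambda>n. prob (A n \<inter> B n)) sums prob (\<Union>n. A n \<inter> B n)"
    using A_sets B_sets
    by (intro finite_measure_UNION) (auto simp: disjoint_family_on_def A_def)
  moreover have "(\<lambda>n. prob (A n \<inter> B n)) sums (exp (- lam) * exp (lam * F t))"
    unfolding pAB_eq by (intro sums_mult exp_converges)
  ultimately have "prob (\<Union>n. A n \<inter> B n) = exp (- lam) * exp (lam * F t)"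
    by (rule sums_unique2)
  also have "\<dots> = exp (- lam * (1 - F t))"
    by (simp add: exp_add[symmetric] algebra_simps)
  also have "(\<Union>n. A n \<inter> B n) = {\<omega> \<in> space M. max_upto (\<lambda>i. X i \<omega>) (N \<omega>) < ereal t}"
    by (auto simp: A_def B_def max_upto_less_iff)
  finally show ?thesis .
qed

theorem theorem7:
  fixes M :: "'a measure"
    and X :: "nat \<Rightarrow> 'a \<Rightarrow> real"
    and N :: "'a \<Rightarrow> nat"
    and F H \<rho> :: "real \<Rightarrow> real"
    and \<tau> lam a b x s :: real
  assumes "prob_space M"
    and "iid_seq M X F"
    and "extreme_value \<tau> H"
    and "F \<in> max_DA H"
    and "lam > 0"
    and "N \<in> measurable M (count_space UNIV)"
    and "distr M (count_space UNIV) N = measure_pmf (poisson_pmf lam)"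
    and "indep_rv M (count_space UNIV) N
           (PiM {1..} (\<lambda>_. borel)) (\<lambda>\<omega>. \<lambda>i\<in>{1..}. X i \<omega>)"
    and "b > 0"
    and "0 < s" and "s < 1"
    and "\<And>y. \<rho> y = lam * (1 - F (a + b * y)) + ln (H y)"
    and "H x > 0"
    and "\<bar>\<rho> x\<bar> \<le> 3 * s"
  shows "\<bar>measure M {\<omega> \<in> space M. max_upto (\<lambda>i. X i \<omega>) (N \<omega>) < ereal (a + b * x)} - H x\<bar>
           \<le> H x * (\<bar>\<rho> x\<bar> + (\<rho> x)\<^sup>2 / (2 * (1 - s)))"
proof -
  interpret prob_space M by fact
  let ?p = "prob {\<omega> \<in> space M. max_upto (\<lambda>i. X i \<omega>) (N \<omega>) < ereal (a + b * x)}"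
  have "?p = exp (- lam * (1 - F (a + b * x)))"
    by (rule prob_max_upto_poisson) fact+
  \<comment> \<open>The definition of \<rho> is solved for the exponent; \<open>H x > 0\<close> then
    turns \<open>exp (ln (H x))\<close> back into \<open>H x\<close>.\<close>
  also have "- lam * (1 - F (a + b * x)) = ln (H x) + - \<rho> x"
    by (simp add: assms(12))
  also have "exp \<dots> = H x * exp (- \<rho> x)"
    using \<open>H x > 0\<close> by (simp only: exp_add exp_ln)
  finally have "\<bar>?p - H x\<bar> = H x * \<bar>exp (- \<rho> x) - 1\<bar>"
    using \<open>H x > 0\<close> abs_mult[of "H x" "exp (- \<rho> x) - 1"] by (simp add: algebra_simps)
  \<comment> \<open>Triangle inequality: the linear term gives the absolute value of
    \<open>\<rho> x\<close>, the remainder gives the quadratic bound.\<close>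
  also have "\<bar>exp (- \<rho> x) - 1\<bar> \<le> \<bar>\<rho> x\<bar> + (\<rho> x)\<^sup>2 / (2 * (1 - s))"
    using exp_minus_linear_bound[of "- \<rho> x" s] \<open>\<bar>\<rho> x\<bar> \<le> 3 * s\<close> \<open>s < 1\<close> by simp
  finally show ?thesis using \<open>H x > 0\<close> by simp
qed

end
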